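(* Let $G=(V,E)$ be a graph and let $\lambda$ be an eigenvalue of the Laplacian (resp. normalized Laplacian, resp. adjacency matrix) of $G$, with multiplicity $\mathrm{mult}(\lambda)$. Let $F$ be an induced forest in $G$ with $l(F)$ leaves, $c(F)$ connected components and no isolated vertices. Then $$\mathrm{mult}(\lambda)\le |G|-|F|+l(F)-c(F).$$ In particular, if $T$ is an induced tree in $G$ with at least $2$ vertices, then $\mathrm{mult}(\lambda)\le |G|-|T|+l(T)-1$. Moreover, if $\lambda\notin\{\deg v: v\in V\}$ (resp. $\lambda\ne 1$ for the normalized Laplacian, resp. $\lambda\neq 0$ for the adjacency matrix) and $F\cup Z$ is an induced forest in $G$ with set of isolated vertices $Z$ (so that $F$ is the part of the forest consisting of the components that are not isolated vertices, with $l(F)$ leaves and $c(F)$ components), then $$\mathrm{mult}(\lambda)\le |G|-|F|+l(F)-c(F)-|Z|.$$ In particular, under this condition on $\lambda$, $\mathrm{mult}(\lambda)\le |G|-\alpha(G)$, where $\alpha(G)$ denotes the largest size of an independent set of vertices of $G$.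
   Context: A graph $G=(V,E)$ is a pair of finite sets with $V\neq\emptyset$ and $E$ a set of $2$-element subsets of $V$; $|G|=|V|$ (and likewise $|F|$, $|T|$ are numbers of vertices), and $\deg v$ is the number of neighbors of $v$. An induced forest (tree) is an induced subgraph that is a forest (tree) as a graph on its own; its isolated vertices are the vertices with no neighbor inside it, and its leaves are its vertices of degree $1$ inside it. Let $A$ denote the adjacency matrix and $D$ the diagonal degree matrix. The Laplacian is $D-A$. The normalized Laplacian is the standard one of spectral graph theory (as in Chung's book): the matrix with diagonal entry $1$ at each vertex of positive degree, entry $-1/\sqrt{\deg v\deg w}$ for adjacent $v,w$, and all other entries $0$. The multiplicity of an eigenvalue is the dimension of its eigenspace in $\mathbb{R}^V$.
   Formalization: In the "Moreover" part, for the normalized Laplacian with λ=0, Z is required to contain no vertex of degree 0 in G (for the α(G) bound: G has no such vertex); otherwise the claim fails, e.g. for the one-vertex graph, where mult(0)=1 but |G|-α(G)=0. *)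

theory Defs
  imports "HOL-Analysis.Analysis"
begin

text \<open>
  A simple graph is given by a vertex set and a set of two-element edges. (The predicates
  \<open>forest\<close> and \<open>tree\<close> of the AFP entry Graph\_Theory concern digraphs; in a
  symmetric digraph every edge is already a directed cycle, so they do not apply here.)
\<close>

definition graph :: "'v set \<Rightarrow> 'v set set \<Rightarrow> bool" where
  "graph V E \<longleftrightarrow> finite V \<and> V \<noteq> {} \<and> finite E \<and> (\<forall>e\<in>E. e \<subseteq> V \<and> card e = 2)"

definition neighbors :: "'v set set \<Rightarrow> 'v \<Rightarrow> 'v set" where
  "neighbors E v = {w. {v, w} \<in> E}"

definition deg :: "'v set set \<Rightarrow> 'v \<Rightarrow> nat" where
  "deg E v = card (neighbors E v)"

definition isolated_vertices :: "'v set \<Rightarrow> 'v set set \<Rightarrow> 'v set" where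
  "isolated_vertices V E = {v \<in> V. neighbors E v = {}}"

definition leaves :: "'v set \<Rightarrow> 'v set set \<Rightarrow> 'v set" where
  "leaves V E = {v \<in> V. deg E v = 1}"

definition connectivity :: "'v set \<Rightarrow> 'v set set \<Rightarrow> ('v \<times> 'v) set" where
  "connectivity V E = {(u, v). u \<in> V \<and> v \<in> V \<and> (u, v) \<in> {(x, y). {x, y} \<in> E}\<^sup>*}"

definition graph_components :: "'v set \<Rightarrow> 'v set set \<Rightarrow> 'v set set" where
  "graph_components V E = V // connectivity V E"

definition connected_graph :: "'v set \<Rightarrow> 'v set set \<Rightarrow> bool" where
  "connected_graph V E \<longleftrightarrow> (\<forall>u\<in>V. \<forall>v\<in>V. (u, v) \<in> connectivity V E)"

text \<open>A cycle is the list of its (at least three, pairwise distinct) vertices in cyclic order.\<close>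

definition graph_cycle :: "'v set set \<Rightarrow> 'v list \<Rightarrow> bool" where
  "graph_cycle E vs \<longleftrightarrow> length vs \<ge> 3 \<and> distinct vs \<and>
     (\<forall>i<length vs. {vs ! i, vs ! (Suc i mod length vs)} \<in> E)"

definition forest :: "'v set \<Rightarrow> 'v set set \<Rightarrow> bool" where
  "forest V E \<longleftrightarrow> graph V E \<and> (\<nexists>vs. graph_cycle E vs)"

definition tree :: "'v set \<Rightarrow> 'v set set \<Rightarrow> bool" where
  "tree V E \<longleftrightarrow> forest V E \<and> connected_graph V E"

definition induced_edges :: "'v set set \<Rightarrow> 'v set \<Rightarrow> 'v set set" where
  "induced_edges E S = {e \<in> E. e \<subseteq> S}"

definition independent_vertices :: "'v set \<Rightarrow> 'v set set \<Rightarrow> 'v set \<Rightarrow> bool" where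
  "independent_vertices V E S \<longleftrightarrow> S \<subseteq> V \<and> (\<forall>u\<in>S. \<forall>v\<in>S. {u, v} \<notin> E)"

definition independence_number :: "'v set \<Rightarrow> 'v set set \<Rightarrow> nat" where
  "independence_number V E = Max (card ` {S. independent_vertices V E S})"

text \<open>
  For the matrices the vertex set is the whole (finite) type \<open>'v\<close>, so that
  $\mathbb{R}^V$ is \<open>real ^ 'v\<close>.
\<close>

definition adjacency_matrix :: "'v::finite set set \<Rightarrow> real ^ 'v ^ 'v" where
  "adjacency_matrix E = (\<chi> v w. if {v, w} \<in> E then 1 else 0)"

definition degree_matrix :: "'v::finite set set \<Rightarrow> real ^ 'v ^ 'v" where
  "degree_matrix E = (\<chi> v w. if v = w then real (deg E v) else 0)"

definition laplacian :: "'v::finite set set \<Rightarrow> real ^ 'v ^ 'v" where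
  "laplacian E = degree_matrix E - adjacency_matrix E"

definition normalized_laplacian :: "'v::finite set set \<Rightarrow> real ^ 'v ^ 'v" where
  "normalized_laplacian E = (\<chi> v w.
     if v = w \<and> deg E v > 0 then 1
     else if {v, w} \<in> E then - 1 / sqrt (real (deg E v) * real (deg E w))
     else 0)"

definition eigenspace :: "real ^ 'n ^ 'n \<Rightarrow> real \<Rightarrow> (real ^ 'n) set" where
  "eigenspace M c = {x. M *v x = c *s x}"

definition eigenvalue :: "real ^ 'n ^ 'n \<Rightarrow> real \<Rightarrow> bool" where
  "eigenvalue M c \<longleftrightarrow> (\<exists>x\<in>eigenspace M c. x \<noteq> 0)"

definition multiplicity_of :: "real ^ 'n ^ 'n \<Rightarrow> real \<Rightarrow> nat" where
  "multiplicity_of M c = dim (eigenspace M c)"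

text \<open>
  The condition on an eigenvalue \<open>c\<close> of \<open>M\<close> under which the vertices of \<open>Z\<close> improve the bound:
  \<open>c\<close> avoids all degrees for the Laplacian, \<open>c \<noteq> 1\<close> for the normalized Laplacian and \<open>c \<noteq> 0\<close> for
  the adjacency matrix. A vertex without neighbors has diagonal entry 0, not 1, in the normalized
  Laplacian. Hence for this matrix and \<open>c = 0\<close> the set \<open>Z\<close> must contain no such vertex: the
  one-vertex graph has the eigenvalue 0 with multiplicity 1, while \<open>|G| - \<alpha>(G) = 0\<close>.
\<close>

definition admissible ::
    "'v::finite set set \<Rightarrow> real ^ 'v ^ 'v \<Rightarrow> real \<Rightarrow> 'v set \<Rightarrow> bool" where
  "admissible E M c Z \<longleftrightarrow>
     M = laplacian E \<and> c \<notin> {real (deg E v) | v. v \<in> UNIV} \<or>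
     M = normalized_laplacian E \<and> c \<noteq> 1 \<and> (c = 0 \<longrightarrow> (\<forall>z\<in>Z. deg E z > 0)) \<or>
     M = adjacency_matrix E \<and> c \<noteq> 0"

end

theory Submission
  imports Defs
begin

text \<open>
  Entry \<open>(v, w)\<close> off the diagonal of any of the three matrices \<open>M\<close> is nonzero exactly when \<open>v\<close> and
  \<open>w\<close> are adjacent; besides this, only the diagonal entries at the vertices of \<open>Z\<close> matter
  (\<open>vertex_forest_bound\<close>).

  The multiplicity of \<open>c\<close> is bounded by a set \<open>S\<close> of vertices such that an eigenvector
  vanishing on \<open>S\<close> vanishes everywhere: then restriction to \<open>S\<close> is injective on the eigenspace
  (\<open>dim_le_card_determining_set\<close>). Let \<open>S\<close> consist of all vertices outside \<open>F \<union> Z\<close> together with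
  all leaves of \<open>F\<close> except one in each component. It has \<open>|G| - |F| - |Z| + l(F) - c(F)\<close>
  elements.

  Suppose that an eigenvector \<open>x\<close> vanishes on \<open>S\<close>, and let \<open>A\<close> be its support in \<open>F\<close>. The
  eigenvector equation at a zero \<open>v\<close> of \<open>x\<close> shows that \<open>v\<close> cannot have exactly one neighbor at which
  \<open>x\<close> is nonzero. So consider a path in \<open>F\<close> in which of any two consecutive vertices at least one
  lies in \<open>A\<close>. At an end outside \<open>A\<close> it can be continued to a second neighbor in \<open>A\<close>, and at an end
  in \<open>A\<close> to any second neighbor; as \<open>F\<close> has no cycle, the result is again a path. Hence a
  longest such path ends at two distinct leaves in \<open>A\<close>, which lie in one component
  (\<open>forest_two_leaves\<close>). But \<open>x\<close> vanishes at all leaves of a component except one. So \<open>A\<close> is empty,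
  and \<open>x\<close> is zero outside \<open>Z\<close>. At a vertex of \<open>Z\<close> the equation then says that \<open>c\<close> is the diagonal
  entry there or \<open>x\<close> is zero, and the condition on \<open>c\<close> excludes the former. Applied to a component
  in place of \<open>A\<close>, the argument also shows that each component has a leaf.
\<close>

section \<open>Paths and leaves in forests\<close>

lemma forest_edge:
  assumes "forest V E" "{x, y} \<in> E"
  shows "x \<in> V" "y \<in> V" "x \<noteq> y"
  using assms unfolding forest_def graph_def by fastforce+

lemma path_closing_edge_is_cycle:
  assumes "distinct p" "length p \<ge> 3" "successively (\<lambda>x y. {x, y} \<in> E) p" "{last p, hd p} \<in> E"
  shows "graph_cycle E p"
  unfolding graph_cycle_def
proof (intro conjI allI impI)
  fix i assume i: "i < length p"
  show "{p ! i, p ! (Suc i mod length p)} \<in> E"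
  proof (cases "Suc i < length p")
    case True
    with assms(3) show ?thesis by (simp add: successively_conv_nth)
  next
    case False
    with i have "Suc i = length p" by simp
    then have "i = length p - 1" by simp
    with assms \<open>Suc i = length p\<close> show ?thesis
      by (metis hd_conv_nth last_conv_nth length_0_conv mod_self nat.distinct(1))
  qed
qed (use assms in auto)

text \<open>
  In a forest, extending a path at its head by any neighbor other than the next vertex gives a path
  again, since running into an earlier vertex would close a cycle.
\<close>

lemma forest_path_no_chord:
  assumes F: "forest V E" and p: "distinct (x # y # q)"
    and succ: "successively (\<lambda>x y. {x, y} \<in> E) (x # y # q)"
    and z: "{x, z} \<in> E" "z \<noteq> y"
  shows "z \<notin> set (x # y # q)"
proof
  assume "z \<in> set (x # y # q)"
  moreover have "z \<noteq> x" using forest_edge[OF F z(1)] by simp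
  ultimately have "z \<in> set q" using z by simp
  then obtain ps qs where q: "q = ps @ z # qs" by (meson split_list)
  have e: "x # y # q = (x # y # ps @ [z]) @ qs" using q by simp
  have "graph_cycle E (x # y # ps @ [z])"
  proof (rule path_closing_edge_is_cycle)
    show "distinct (x # y # ps @ [z])" using p q by auto
    show "successively (\<lambda>x y. {x, y} \<in> E) (x # y # ps @ [z])"
      using succ unfolding e successively_append_iff by blast
    show "{last (x # y # ps @ [z]), hd (x # y # ps @ [z])} \<in> E"
      using z by (simp add: insert_commute)
  qed simp
  then show False using F by (auto simp: forest_def)
qed

lemma successively_rtrancl:
  "successively (\<lambda>x y. (x, y) \<in> r) p \<Longrightarrow> p \<noteq> [] \<Longrightarrow> (hd p, last p) \<in> r\<^sup>*"
  by (induction p) (auto simp: successively_Cons intro: converse_rtrancl_into_rtrancl)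

text \<open>
  The hypothesis \<open>second\<close> is what the eigenvector equation gives for the support \<open>A\<close> of an
  eigenvector. It also holds, for lack of edges leaving \<open>A\<close>, when \<open>A\<close> is a component.
\<close>

lemma forest_two_leaves:
  assumes F: "forest V E" and A: "A \<subseteq> V" "A \<noteq> {}"
    and nbr: "\<And>a. a \<in> A \<Longrightarrow> neighbors E a \<noteq> {}"
    and second: "\<And>v a. v \<in> V - A \<Longrightarrow> a \<in> A \<Longrightarrow> {v, a} \<in> E \<Longrightarrow> \<exists>b\<in>A. b \<noteq> a \<and> {v, b} \<in> E"
  obtains u w where "u \<in> A \<inter> leaves V E" "w \<in> A \<inter> leaves V E" "u \<noteq> w"
    "(u, w) \<in> connectivity V E"
proof -
  \<comment> \<open>Paths may pass through single vertices outside \<open>A\<close>, but never through two in a row: at an end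
    outside \<open>A\<close> this leaves a neighbor in \<open>A\<close> from which \<open>second\<close> produces another.\<close>
  define link where "link = (\<lambda>x y. {x, y} \<in> E \<and> (x \<in> A \<or> y \<in> A))"
  define P where "P = (\<lambda>p. distinct p \<and> length p \<ge> 2 \<and> set p \<subseteq> V \<and> successively link p)"
  have link_sym: "(\<lambda>x y. link y x) = link"
    by (auto simp: link_def insert_commute fun_eq_iff)
  have P_rev: "P (rev p) \<longleftrightarrow> P p" for p
    unfolding P_def successively_rev link_sym by simp
  have "finite V" using F by (simp add: forest_def graph_def)
  obtain a b where ab: "a \<in> A" "{a, b} \<in> E"
    using A nbr unfolding neighbors_def by blast
  then have "P [a, b]" using forest_edge[OF F ab(2)] by (auto simp: P_def link_def)
  moreover have bound: "length p < Suc (card V)" if "P p" for p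
    using that \<open>finite V\<close> card_mono[of V "set p"] by (simp add: P_def distinct_card)
  ultimately obtain p where p: "P p" and longest: "\<And>p'. P p' \<Longrightarrow> length p' \<le> length p"
    using ex_has_greatest_nat[of P "[a, b]" length "Suc (card V)"] by (metis less_imp_le)
  have hd_leaf: "hd p \<in> A \<inter> leaves V E"
    if p: "P p" and longest: "\<And>p'. P p' \<Longrightarrow> length p' \<le> length p" for p
  proof -
    obtain x y q where xyq: "p = x # y # q"
      using p by (cases p; cases "tl p") (auto simp: P_def)
    have xy: "{x, y} \<in> E" "x \<in> A \<or> y \<in> A" using p by (auto simp: xyq P_def link_def)
    have E_path: "successively (\<lambda>x y. {x, y} \<in> E) (x # y # q)"
      by (rule successively_mono[of link]) (use p in \<open>simp_all add: xyq P_def link_def\<close>)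
    have no_ext: "z = y" if z: "{x, z} \<in> E" "x \<in> A \<or> z \<in> A" for z
    proof (rule ccontr)
      assume "z \<noteq> y"
      then have "z \<notin> set p"
        using forest_path_no_chord[OF F _ E_path z(1)] p by (simp add: xyq P_def)
      then have "P (z # p)"
        using p z forest_edge[OF F z(1)]
        by (auto simp: P_def xyq link_def insert_commute)
      then show False using longest by fastforce
    qed
    have "x \<in> V" using forest_edge[OF F xy(1)] by simp
    have "x \<in> A"
    proof (rule ccontr)
      assume "x \<notin> A"
      then obtain b where "b \<in> A" "b \<noteq> y" "{x, b} \<in> E"
        using second[of x y] xy \<open>x \<in> V\<close> by auto
      then show False using no_ext by auto
    qed
    then have "z = y" if "z \<in> neighbors E x" for z
      using no_ext[of z] that by (simp add: neighbors_def)
    moreover have "y \<in> neighbors E x" using xy(1) by (simp add: neighbors_def)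
    ultimately have "neighbors E x = {y}" by blast
    then show ?thesis using \<open>x \<in> A\<close> \<open>x \<in> V\<close> by (simp add: leaves_def deg_def xyq)
  qed
  have ne: "p \<noteq> []" using p by (auto simp: P_def)
  have hd: "hd p \<in> A \<inter> leaves V E" using hd_leaf[OF p longest] .
  \<comment> \<open>The reversed path is a longest one as well.\<close>
  have last: "last p \<in> A \<inter> leaves V E"
    using hd_leaf[of "rev p"] p longest unfolding P_rev length_rev hd_rev by blast
  have "hd p \<noteq> last p"
    using p by (cases p) (auto simp: P_def)
  moreover have "(hd p, last p) \<in> connectivity V E"
  proof -
    have "successively (\<lambda>x y. (x, y) \<in> {(x, y). {x, y} \<in> E}) p"
      by (rule successively_mono[of link]) (use p in \<open>simp_all add: P_def link_def\<close>)
    from successively_rtrancl[OF this ne] show ?thesis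
      using hd last A by (auto simp: connectivity_def)
  qed
  ultimately show ?thesis using that hd last by blast
qed

lemma equiv_connectivity: "equiv V (connectivity V E)"
proof (rule equivI)
  have "sym ({(x, y). {x, y} \<in> E}\<^sup>*)"
    by (rule sym_rtrancl) (auto simp: sym_def insert_commute)
  then show "sym (connectivity V E)" by (auto simp: connectivity_def sym_def)
qed (auto simp: connectivity_def refl_on_def trans_def intro: rtrancl_trans)

lemma component_closed:
  assumes "C \<in> graph_components V E" "a \<in> C" "{v, a} \<in> E" "v \<in> V"
  shows "v \<in> C"
proof -
  have C: "C \<in> V // connectivity V E" using assms(1) by (simp add: graph_components_def)
  have "a \<in> V" using in_quotient_imp_subset[OF equiv_connectivity C] assms(2) by blast
  then have "(a, v) \<in> connectivity V E"
    using assms by (auto simp: connectivity_def insert_commute)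
  then show ?thesis using in_quotient_imp_closed[OF equiv_connectivity C assms(2)] by blast
qed

text \<open>
  This makes it possible to leave out one leaf of each component when the determining set is formed.
\<close>

lemma component_has_leaf:
  assumes F: "forest V E" and iso: "isolated_vertices V E = {}"
    and C: "C \<in> graph_components V E"
  shows "\<exists>u \<in> C. u \<in> leaves V E"
proof -
  note Q = C[unfolded graph_components_def]
  have sub: "C \<subseteq> V" by (rule in_quotient_imp_subset[OF equiv_connectivity Q])
  have ne: "C \<noteq> {}" by (rule in_quotient_imp_non_empty[OF equiv_connectivity Q])
  show ?thesis
  proof (rule forest_two_leaves[OF F sub ne])
    show "neighbors E a \<noteq> {}" if "a \<in> C" for a
      using iso that sub by (auto simp: isolated_vertices_def)
    show "\<exists>b\<in>C. b \<noteq> a \<and> {v, b} \<in> E" if "v \<in> V - C" "a \<in> C" "{v, a} \<in> E" for v a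
      using component_closed[OF C] that by blast
  qed blast
qed

section \<open>Multiplicity and vertices that determine an eigenvector\<close>

lemma dim_le_card_determining_set:
  fixes W :: "(real ^ 'n) set"
  assumes "subspace W" and zero: "\<And>x. x \<in> W \<Longrightarrow> (\<forall>i\<in>S. x $ i = 0) \<Longrightarrow> x = 0"
  shows "dim W \<le> card S"
proof -
  define f where "f = (\<lambda>x :: real ^ 'n. (\<chi> i. if i \<in> S then x $ i else 0) :: real ^ 'n)"
  have lin: "linear f" by (rule linearI) (auto simp: f_def vec_eq_iff)
  have "inj_on f (span W)"
  proof (rule inj_onI)
    fix x y assume "x \<in> span W" "y \<in> span W" and eq: "f x = f y"
    then have "x - y \<in> W" using assms(1) by (metis span_eq_iff span_diff)
    moreover have "\<forall>i\<in>S. (x - y) $ i = 0"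
      using eq by (auto simp: f_def vec_eq_iff split: if_splits)
    ultimately show "x = y" using zero[of "x - y"] by simp
  qed
  then have "dim W = dim (f ` W)" by (rule dim_image_eq[OF lin, symmetric])
  also have "\<dots> \<le> dim {x :: real ^ 'n. \<forall>i. i \<notin> S \<longrightarrow> x $ i = 0}"
    by (rule dim_subset) (auto simp: f_def)
  also have "\<dots> = card S" unfolding dim_vec_eq[symmetric] by (rule dim_substandard_cart)
  finally show ?thesis .
qed

lemma eigenspace_component:
  "x \<in> eigenspace M c \<Longrightarrow> (\<Sum>w\<in>UNIV. M $ v $ w * x $ w) = c * x $ v"
  by (auto simp: eigenspace_def vec_eq_iff matrix_vector_mult_def)

lemma subspace_eigenspace: "subspace (eigenspace M c)"
  unfolding subspace_def eigenspace_def
  by (simp add: matrix_vector_right_distrib matrix_vector_mult_scaleR scalar_mult_eq_scaleR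
      scaleR_add_right)

definition supported_on_graph :: "'v::finite set set \<Rightarrow> real ^ 'v ^ 'v \<Rightarrow> bool" where
  "supported_on_graph E M \<longleftrightarrow> (\<forall>v w. v \<noteq> w \<longrightarrow> (M $ v $ w \<noteq> 0 \<longleftrightarrow> {v, w} \<in> E))"

text \<open>
  At a zero \<open>v\<close> the diagonal entry drops out of the eigenvector equation, so the terms of the
  neighbors of \<open>v\<close> add up to 0. A single nonzero term is impossible.
\<close>

lemma eigenvector_second_neighbor:
  assumes M: "supported_on_graph E M" and x: "x \<in> eigenspace M c"
    and v: "x $ v = 0" and a: "x $ a \<noteq> 0" "{v, a} \<in> E"
  shows "\<exists>b. b \<noteq> a \<and> x $ b \<noteq> 0 \<and> {v, b} \<in> E"
proof (rule ccontr)
  assume no: "\<not> ?thesis"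
  have entry: "M $ v $ w * x $ w = (if w = a then M $ v $ a * x $ a else 0)" for w
    using M no v unfolding supported_on_graph_def by (metis mult_eq_0_iff)
  have "(\<Sum>w\<in>UNIV. M $ v $ w * x $ w) = (\<Sum>w\<in>UNIV. if w = a then M $ v $ a * x $ a else 0)"
    by (intro sum.cong refl) (rule entry)
  also have "\<dots> = M $ v $ a * x $ a" by simp
  finally have "M $ v $ a * x $ a = 0" using eigenspace_component[OF x, of v] v by simp
  then show False using M v a unfolding supported_on_graph_def by (metis mult_eq_0_iff)
qed

text \<open>
  If \<open>x\<close> vanishes at all neighbors of \<open>z\<close>, the eigenvector equation at \<open>z\<close> reduces to
  \<open>M $ z $ z * x $ z = c * x $ z\<close>.
\<close>

lemma eigenvector_diagonal_entry:
  assumes M: "supported_on_graph E M" and x: "x \<in> eigenspace M c"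
    and nbrs: "\<And>w. w \<noteq> z \<Longrightarrow> {z, w} \<in> E \<Longrightarrow> x $ w = 0" and z: "M $ z $ z \<noteq> c"
  shows "x $ z = 0"
proof -
  have entry: "M $ z $ w * x $ w = (if w = z then M $ z $ z * x $ z else 0)" for w
    using M nbrs unfolding supported_on_graph_def by (metis mult_eq_0_iff)
  have "(\<Sum>w\<in>UNIV. M $ z $ w * x $ w) = (\<Sum>w\<in>UNIV. if w = z then M $ z $ z * x $ z else 0)"
    by (intro sum.cong refl) (rule entry)
  also have "\<dots> = M $ z $ z * x $ z" by simp
  finally show ?thesis using eigenspace_component[OF x, of z] z by simp
qed

section \<open>The bound for one forest\<close>

lemma neighbors_induced_iff:
  "w \<in> neighbors (induced_edges E F) v \<longleftrightarrow> {v, w} \<in> E \<and> v \<in> F \<and> w \<in> F"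
  by (auto simp: neighbors_def induced_edges_def)

text \<open>
  All four bounds are instances: \<open>Z\<close> is empty in the first two, and \<open>F\<close> is empty for independent
  sets. A forest has at least one vertex by definition, hence the case distinction on \<open>F\<close> in the
  hypothesis.
\<close>

lemma vertex_forest_bound:
  fixes E :: "'v::finite set set" and M :: "real ^ 'v ^ 'v" and F Z :: "'v set"
  defines "EF \<equiv> induced_edges E F"
  assumes M: "supported_on_graph E M"
    and forest: "F \<noteq> {} \<Longrightarrow> forest F EF" and iso: "isolated_vertices F EF = {}"
    and disj: "F \<inter> Z = {}" and Z_edges: "\<And>z w. z \<in> Z \<Longrightarrow> w \<in> F \<union> Z \<Longrightarrow> {z, w} \<notin> E"
    and Z_diag: "\<And>z. z \<in> Z \<Longrightarrow> M $ z $ z \<noteq> c"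
  shows "int (multiplicity_of M c) \<le> int CARD('v) - int (card F) + int (card (leaves F EF))
    - int (card (graph_components F EF)) - int (card Z)"
proof -
  let ?comps = "graph_components F EF"
  note Q = equiv_connectivity[of F EF]
  have forest_comp: "forest F EF" if "C \<in> ?comps" for C
    using forest that by (auto simp: graph_components_def quotient_def)
  have "\<forall>C\<in>?comps. \<exists>u. u \<in> C \<and> u \<in> leaves F EF"
    using component_has_leaf[OF forest_comp iso] by blast
  then obtain r where r: "\<And>C. C \<in> ?comps \<Longrightarrow> r C \<in> C \<and> r C \<in> leaves F EF"
    by metis
  define R where "R = r ` ?comps"
  have R_leaves: "R \<subseteq> leaves F EF" using r by (auto simp: R_def)
  have R_inj: "C = C'"
    if "C \<in> ?comps" "C' \<in> ?comps" "(r C, r C') \<in> connectivity F EF" for C C'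
    using quotient_eq_iff[OF Q, of C C' "r C" "r C'"] that r by (auto simp: graph_components_def)
  have "inj_on r ?comps"
  proof (rule inj_onI)
    fix C C' assume C: "C \<in> ?comps" "C' \<in> ?comps" "r C = r C'"
    then have "r C \<in> C \<inter> C'" using r[of C] r[of C'] by simp
    then show "C = C'"
      using quotient_disj[OF Q, of C C'] C by (auto simp: graph_components_def)
  qed
  then have card_R: "card R = card ?comps" by (simp add: R_def card_image)
  have leaves_F: "leaves F EF \<subseteq> F" by (auto simp: leaves_def)
  \<comment> \<open>\<open>R\<close> holds the leaf that is left out in each component.\<close>
  define S where "S = (- (F \<union> Z)) \<union> (leaves F EF - R)"
  have "multiplicity_of M c \<le> card S"
    unfolding multiplicity_of_def
  proof (rule dim_le_card_determining_set[OF subspace_eigenspace])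
    fix x assume x: "x \<in> eigenspace M c" and x0: "\<forall>i\<in>S. x $ i = 0"
    define A where "A = {v \<in> F. x $ v \<noteq> 0}"
    have "A = {}"
    proof (rule ccontr)
      assume "A \<noteq> {}"
      then have "F \<noteq> {}" by (auto simp: A_def)
      have second: "\<exists>b\<in>A. b \<noteq> a \<and> {v, b} \<in> EF"
        if v: "v \<in> F - A" and a: "a \<in> A" "{v, a} \<in> EF" for v a
      proof -
        have "x $ v = 0" "x $ a \<noteq> 0" "{v, a} \<in> E"
          using v a by (auto simp: A_def EF_def induced_edges_def)
        from eigenvector_second_neighbor[OF M x this]
        obtain b where b: "b \<noteq> a" "x $ b \<noteq> 0" "{v, b} \<in> E" by blast
        have "b \<notin> Z" using Z_edges[of b v] b v by (auto simp: insert_commute)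
        moreover have "b \<in> F \<union> Z" using x0 b by (auto simp: S_def)
        ultimately have "b \<in> F" by blast
        then show ?thesis using b v by (auto simp: A_def EF_def induced_edges_def)
      qed
      have "A \<subseteq> F" by (auto simp: A_def)
      moreover have "neighbors EF a \<noteq> {}" if "a \<in> A" for a
        using that iso by (auto simp: A_def isolated_vertices_def)
      ultimately obtain u w where uw: "u \<in> A \<inter> leaves F EF" "w \<in> A \<inter> leaves F EF" "u \<noteq> w"
        "(u, w) \<in> connectivity F EF"
        using forest_two_leaves[OF forest[OF \<open>F \<noteq> {}\<close>] _ \<open>A \<noteq> {}\<close> _ second] by blast
      then have "u \<in> R" "w \<in> R" using x0 by (auto simp: A_def S_def)
      then show False using R_inj uw by (auto simp: R_def)
    qed
    then have nonZ: "x $ v = 0" if "v \<notin> Z" for v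
      using x0 that by (auto simp: A_def S_def)
    have "x $ z = 0" if z: "z \<in> Z" for z
      by (rule eigenvector_diagonal_entry[OF M x _ Z_diag[OF z]])
         (use Z_edges[OF z] nonZ in blast)
    with nonZ show "x = 0" by (metis vec_eq_iff zero_index)
  qed
  moreover have "int (card S) = int CARD('v) - int (card F) - int (card Z)
      + (int (card (leaves F EF)) - int (card ?comps))"
  proof -
    have "card S = card (- (F \<union> Z)) + card (leaves F EF - R)"
      unfolding S_def using leaves_F by (intro card_Un_disjoint) auto
    moreover have "int (card (- (F \<union> Z))) = int CARD('v) - (int (card F) + int (card Z))"
      using card_Un_disjoint[of F Z] disj card_mono[of UNIV "F \<union> Z"]
      by (simp add: card_Diff_subset Compl_eq_Diff_UNIV of_nat_diff)
    moreover have "int (card (leaves F EF - R)) = int (card (leaves F EF)) - int (card ?comps)"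
      using R_leaves card_R card_mono[of "leaves F EF" R]
      by (simp add: card_Diff_subset finite_subset of_nat_diff)
    ultimately show ?thesis by simp
  qed
  ultimately show ?thesis by linarith
qed

section \<open>The three matrices of a graph\<close>

lemma graph_no_loop: "graph V E \<Longrightarrow> {v, v} \<notin> E"
  by (auto simp: graph_def)

lemma graph_matrices_supported_on_graph:
  fixes E :: "'v::finite set set"
  assumes "M \<in> {laplacian E, normalized_laplacian E, adjacency_matrix E}"
  shows "supported_on_graph E M"
proof -
  have "deg E v \<noteq> 0 \<and> deg E w \<noteq> 0" if "{v, w} \<in> E" for v w
    using that by (auto simp: deg_def neighbors_def insert_commute)
  then have "sqrt (real (deg E v) * real (deg E w)) \<noteq> 0" if "{v, w} \<in> E" for v w
    using that by simp
  then show ?thesis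
    using assms
    by (auto simp: supported_on_graph_def laplacian_def normalized_laplacian_def
        adjacency_matrix_def degree_matrix_def simp del: real_sqrt_eq_0_iff split: if_splits)
qed

lemma admissible_diagonal:
  fixes E :: "'v::finite set set"
  assumes "graph (UNIV :: 'v set) E" "admissible E M c Z" "z \<in> Z"
  shows "M $ z $ z \<noteq> c"
  using assms(2,3) graph_no_loop[OF assms(1), of z]
  by (auto simp: admissible_def laplacian_def normalized_laplacian_def
      adjacency_matrix_def degree_matrix_def split: if_splits)

lemma tree_no_isolated_vertices:
  assumes "tree T E" "card T \<ge> 2"
  shows "isolated_vertices T E = {}"
proof -
  have "neighbors E v \<noteq> {}" if "v \<in> T" for v
  proof -
    have "T \<noteq> {v}" using assms(2) by auto
    then obtain w where "w \<in> T" "w \<noteq> v" using \<open>v \<in> T\<close> by blast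
    then have "(v, w) \<in> {(x, y). {x, y} \<in> E}\<^sup>*"
      using assms(1) \<open>v \<in> T\<close> by (auto simp: tree_def connected_graph_def connectivity_def)
    with \<open>w \<noteq> v\<close> show ?thesis
      by (auto simp: neighbors_def elim: converse_rtranclE)
  qed
  then show ?thesis by (auto simp: isolated_vertices_def)
qed

lemma induced_edges_remove_isolated:
  fixes E :: "'v set set"
  assumes "graph V E"
    and Z: "isolated_vertices (F \<union> Z) (induced_edges E (F \<union> Z)) = Z"
  shows "induced_edges E (F \<union> Z) = induced_edges E F"
    and "\<And>z w. z \<in> Z \<Longrightarrow> w \<in> F \<union> Z \<Longrightarrow> {z, w} \<notin> E"
proof -
  show no: "{z, w} \<notin> E" if "z \<in> Z" "w \<in> F \<union> Z" for z w
    using Z that neighbors_induced_iff[of w E "F \<union> Z" z] by (auto simp: isolated_vertices_def)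
  have "e \<subseteq> F" if e: "e \<in> E" "e \<subseteq> F \<union> Z" for e
  proof -
    obtain u w where "e = {u, w}"
      using assms(1) e unfolding graph_def card_2_iff by blast
    then show ?thesis using e no[of u w] no[of w u] by (auto simp: insert_commute)
  qed
  then show "induced_edges E (F \<union> Z) = induced_edges E F"
    by (auto simp: induced_edges_def)
qed

lemma forest_remove_isolated:
  assumes "forest (F \<union> Z) (induced_edges E (F \<union> Z))"
    and "induced_edges E (F \<union> Z) = induced_edges E F" "F \<noteq> {}"
  shows "forest F (induced_edges E F)"
  using assms by (auto simp: forest_def graph_def induced_edges_def)

lemma independence_number_attained:
  assumes "finite V"
  obtains S where "independent_vertices V E S" "card S = independence_number V E"
proof -
  have "finite {S. independent_vertices V E S}"
    by (rule finite_subset[of _ "Pow V"]) (use assms in \<open>auto simp: independent_vertices_def\<close>)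
  moreover have "{} \<in> {S. independent_vertices V E S}" by (simp add: independent_vertices_def)
  ultimately have "independence_number V E \<in> card ` {S. independent_vertices V E S}"
    unfolding independence_number_def by (intro Max_in) auto
  then show ?thesis using that by auto
qed

theorem corollary21:
  fixes E :: "'v::finite set set" and M :: "real ^ 'v ^ 'v" and c :: real
  assumes "graph (UNIV :: 'v set) E"
    and "M \<in> {laplacian E, normalized_laplacian E, adjacency_matrix E}"
    and "eigenvalue M c"
  shows
    "(\<forall>F. forest F (induced_edges E F) \<and> isolated_vertices F (induced_edges E F) = {} \<longrightarrow>
        int (multiplicity_of M c) \<le>
          int CARD('v) - int (card F) + int (card (leaves F (induced_edges E F)))
          - int (card (graph_components F (induced_edges E F)))) \<and>
     (\<forall>T. tree T (induced_edges E T) \<and> card T \<ge> 2 \<longrightarrow>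
        int (multiplicity_of M c) \<le>
          int CARD('v) - int (card T) + int (card (leaves T (induced_edges E T))) - 1) \<and>
     (\<forall>F Z. forest (F \<union> Z) (induced_edges E (F \<union> Z)) \<and> F \<inter> Z = {} \<and>
        isolated_vertices (F \<union> Z) (induced_edges E (F \<union> Z)) = Z \<and> admissible E M c Z \<longrightarrow>
        int (multiplicity_of M c) \<le>
          int CARD('v) - int (card F) + int (card (leaves F (induced_edges E F)))
          - int (card (graph_components F (induced_edges E F))) - int (card Z)) \<and>
     (admissible E M c UNIV \<longrightarrow>
        int (multiplicity_of M c) \<le>
          int CARD('v) - int (independence_number (UNIV :: 'v set) E))"
proof (intro conjI allI impI)
  note M = graph_matrices_supported_on_graph[OF assms(2)]
  have forest_bound: "int (multiplicity_of M c) \<le>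
      int CARD('v) - int (card F) + int (card (leaves F (induced_edges E F)))
      - int (card (graph_components F (induced_edges E F)))"
    if "forest F (induced_edges E F)" "isolated_vertices F (induced_edges E F) = {}" for F
    using vertex_forest_bound[OF M, of F "{}" c] that by simp
  show "int (multiplicity_of M c) \<le>
      int CARD('v) - int (card F) + int (card (leaves F (induced_edges E F)))
      - int (card (graph_components F (induced_edges E F)))"
    if "forest F (induced_edges E F) \<and> isolated_vertices F (induced_edges E F) = {}" for F
    using forest_bound that by blast
  show "int (multiplicity_of M c) \<le>
      int CARD('v) - int (card T) + int (card (leaves T (induced_edges E T))) - 1"
    if T: "tree T (induced_edges E T) \<and> card T \<ge> 2" for T
  proof -
    \<comment> \<open>As the number of components enters negatively, it is enough that there is at least one.\<close>
    have "T \<noteq> {}" using T by auto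
    then have "graph_components T (induced_edges E T) \<noteq> {}"
      by (auto simp: graph_components_def quotient_def)
    then have "card (graph_components T (induced_edges E T)) \<ge> 1"
      by (metis One_nat_def Suc_leI card_gt_0_iff finite)
    then show ?thesis
      using forest_bound[of T] tree_no_isolated_vertices[of T] T by (auto simp: tree_def)
  qed
  show "int (multiplicity_of M c) \<le>
      int CARD('v) - int (card F) + int (card (leaves F (induced_edges E F)))
      - int (card (graph_components F (induced_edges E F))) - int (card Z)"
    if FZ: "forest (F \<union> Z) (induced_edges E (F \<union> Z)) \<and> F \<inter> Z = {} \<and>
      isolated_vertices (F \<union> Z) (induced_edges E (F \<union> Z)) = Z \<and> admissible E M c Z" for F Z
  proof -
    have Z: "isolated_vertices (F \<union> Z) (induced_edges E (F \<union> Z)) = Z" using FZ by blast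
    note E_F = induced_edges_remove_isolated[OF assms(1) Z]
    have adm: "admissible E M c Z" using FZ by blast
    show ?thesis
    proof (rule vertex_forest_bound[OF M])
      show "forest F (induced_edges E F)" if "F \<noteq> {}"
        using forest_remove_isolated[OF _ E_F(1) that] FZ by blast
      show "isolated_vertices F (induced_edges E F) = {}"
        using FZ unfolding E_F(1) by (auto simp: isolated_vertices_def)
    qed (use FZ E_F(2) admissible_diagonal[OF assms(1) adm] in auto)
  qed
  show "int (multiplicity_of M c) \<le>
      int CARD('v) - int (independence_number (UNIV :: 'v set) E)"
    if adm: "admissible E M c UNIV"
  proof -
    obtain S where S: "independent_vertices UNIV E S"
      "card S = independence_number (UNIV :: 'v set) E"
      using independence_number_attained[of "UNIV :: 'v set" E] by auto
    have "int (multiplicity_of M c) \<le>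
        int CARD('v) - int (card ({} :: 'v set)) + int (card (leaves {} (induced_edges E {})))
        - int (card (graph_components {} (induced_edges E {}))) - int (card S)"
      by (rule vertex_forest_bound[OF M])
         (use S admissible_diagonal[OF assms(1) adm] in
           \<open>auto simp: independent_vertices_def isolated_vertices_def\<close>)
    then show ?thesis
      by (simp add: S(2) leaves_def graph_components_def)
  qed
qed

end
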